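(* Let $\mathbb{F}$ be a field of characteristic different from two, let $A$ be a finite-dimensional commutative $\mathbb{F}$-algebra, and consider $H\colon A\rightarrow A$ with $H(x)=x^2$. (1) If $H=D\circ L$ is a Waring decomposition of $H$, with $L\colon A\to\mathbb{F}^m$ and $D\colon\mathbb{F}^m\to A$, and $L$ is injective, then $(P_{\widetilde{H}},L)$, with $\widetilde{H}=L\circ D\colon\mathbb{F}^m\to\mathbb{F}^m$, is an evolution envelope of $A$. (2) Conversely, if $(E,\Phi)$ is an evolution envelope of $A$ with $E$ of finite dimension $m$, where $E$ is identified with $\mathbb{F}^m$ by means of a natural basis and $H_E(y)=y^2$ for $y\in E$, then $H=D\circ L$, where $L=\Phi$ and $D=\Phi^{-1}\circ H_E$, is a Waring decomposition of $H$ with $L$ injective.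
   Context: An algebra over a field $\mathbb{F}$ is an $\mathbb{F}$-vector space with a bilinear multiplication, not assumed associative or unital. Algebra morphisms are linear multiplicative maps (not required to preserve a unit). An algebra $E$ over $\mathbb{F}$ is an evolution algebra if it admits a basis $\{e_i : i\in I\}$, called a natural basis, such that $e_ie_j=0$ whenever $i\neq j$. $E^2$ denotes the linear span of all products in $E$. An evolution envelope of a commutative algebra $A$ is a pair $(E,\Phi)$ where $E$ is an evolution $\mathbb{F}$-algebra and $\Phi\colon A\hookrightarrow E$ is an algebra monomorphism with $E^2\subseteq\Phi(A)$. For a homogeneous quadratic polynomial map $H\colon V\to V$ on a finite-dimensional $\mathbb{F}$-vector space $V$ ($\operatorname{char}\mathbb{F}\neq 2$), the polarization algebra $P_H$ is the vector space $V$ with the commutative multiplication $xy=\frac12\big(H(x+y)-H(x)-H(y)\big)$. A (simultaneous) Waring decomposition of $H$ of length $m$ is an expression $H(x)=\sum_{k=1}^m\ell_k(x)^2v_k$ with $\ell_k\in V^*$ and $v_k\in V$; equivalently $H=D\circ L$, where $L\colon V\to\mathbb{F}^m$ is the linear map $L(x)=(\ell_1(x),\dots,\ell_m(x))$ and $D\colon\mathbb{F}^m\to V$ is $D(y_1,\dots,y_m)=\sum_{k=1}^m y_k^2v_k$. *)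

theory Defs
  imports Complex_Main "HOL-Library.Function_Algebras"
begin

text \<open>
  Algebras live on a subspace (the carrier) of an ambient vector space type, given by a scalar
  multiplication in the sense of the locale \<open>vector_space\<close>; the carrier may be the whole type.
  Carriers are used so that the coordinate spaces \<open>F\<^sup>m\<close>, for every natural number \<open>m\<close>
  including \<open>0\<close>, are algebras in the same sense as all others. Only the values of maps and
  multiplications on the carriers matter.
\<close>

locale algebra_on = vector_space scale
  for scale :: "'f::field \<Rightarrow> 'a::ab_group_add \<Rightarrow> 'a" (infixr \<open>*s\<close> 75) +
  fixes A :: "'a set" and mul :: "'a \<Rightarrow> 'a \<Rightarrow> 'a"
  assumes subspace_carrier: "subspace A"
    and mul_closed: "x \<in> A \<Longrightarrow> y \<in> A \<Longrightarrow> mul x y \<in> A"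
    and mul_add_left: "x \<in> A \<Longrightarrow> y \<in> A \<Longrightarrow> z \<in> A \<Longrightarrow> mul (x + y) z = mul x z + mul y z"
    and mul_add_right: "x \<in> A \<Longrightarrow> y \<in> A \<Longrightarrow> z \<in> A \<Longrightarrow> mul x (y + z) = mul x y + mul x z"
    and mul_scale_left: "x \<in> A \<Longrightarrow> y \<in> A \<Longrightarrow> mul (c *s x) y = c *s mul x y"
    and mul_scale_right: "x \<in> A \<Longrightarrow> y \<in> A \<Longrightarrow> mul x (c *s y) = c *s mul x y"

locale commutative_algebra_on = algebra_on +
  assumes mul_commute: "x \<in> A \<Longrightarrow> y \<in> A \<Longrightarrow> mul x y = mul y x"

definition is_basis :: "('f::field \<Rightarrow> 'a::ab_group_add \<Rightarrow> 'a) \<Rightarrow> 'a set \<Rightarrow> 'a set \<Rightarrow> bool" where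
  "is_basis s V B \<longleftrightarrow> \<not> module.dependent s B \<and> module.span s B = V"

definition has_dimension :: "('f::field \<Rightarrow> 'a::ab_group_add \<Rightarrow> 'a) \<Rightarrow> 'a set \<Rightarrow> nat \<Rightarrow> bool" where
  "has_dimension s V m \<longleftrightarrow> (\<exists>B. finite B \<and> is_basis s V B \<and> card B = m)"

definition finite_dimensional :: "('f::field \<Rightarrow> 'a::ab_group_add \<Rightarrow> 'a) \<Rightarrow> 'a set \<Rightarrow> bool" where
  "finite_dimensional s V \<longleftrightarrow> (\<exists>m. has_dimension s V m)"

definition linear_map_on ::
  "('f::field \<Rightarrow> 'a::ab_group_add \<Rightarrow> 'a) \<Rightarrow> 'a set \<Rightarrow> ('f \<Rightarrow> 'b::ab_group_add \<Rightarrow> 'b) \<Rightarrow> 'b set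
    \<Rightarrow> ('a \<Rightarrow> 'b) \<Rightarrow> bool" where
  "linear_map_on s V t W f \<longleftrightarrow>
     f ` V \<subseteq> W \<and>
     (\<forall>x\<in>V. \<forall>y\<in>V. f (x + y) = f x + f y) \<and>
     (\<forall>c. \<forall>x\<in>V. f (s c x) = t c (f x))"

definition algebra_hom ::
  "('f::field \<Rightarrow> 'a::ab_group_add \<Rightarrow> 'a) \<Rightarrow> 'a set \<Rightarrow> ('a \<Rightarrow> 'a \<Rightarrow> 'a)
    \<Rightarrow> ('f \<Rightarrow> 'b::ab_group_add \<Rightarrow> 'b) \<Rightarrow> 'b set \<Rightarrow> ('b \<Rightarrow> 'b \<Rightarrow> 'b) \<Rightarrow> ('a \<Rightarrow> 'b) \<Rightarrow> bool" where
  "algebra_hom s A mulA t E mulE f \<longleftrightarrow>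
     linear_map_on s A t E f \<and> (\<forall>x\<in>A. \<forall>y\<in>A. f (mulA x y) = mulE (f x) (f y))"

definition natural_basis ::
  "('f::field \<Rightarrow> 'a::ab_group_add \<Rightarrow> 'a) \<Rightarrow> 'a set \<Rightarrow> ('a \<Rightarrow> 'a \<Rightarrow> 'a) \<Rightarrow> 'a set \<Rightarrow> bool" where
  "natural_basis s E mul B \<longleftrightarrow>
     is_basis s E B \<and> (\<forall>b\<in>B. \<forall>c\<in>B. b \<noteq> c \<longrightarrow> mul b c = 0)"

definition evolution_algebra ::
  "('f::field \<Rightarrow> 'a::ab_group_add \<Rightarrow> 'a) \<Rightarrow> 'a set \<Rightarrow> ('a \<Rightarrow> 'a \<Rightarrow> 'a) \<Rightarrow> bool" where
  "evolution_algebra s E mul \<longleftrightarrow> algebra_on s E mul \<and> (\<exists>B. natural_basis s E mul B)"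

definition evolution_envelope ::
  "('f::field \<Rightarrow> 'a::ab_group_add \<Rightarrow> 'a) \<Rightarrow> 'a set \<Rightarrow> ('a \<Rightarrow> 'a \<Rightarrow> 'a)
    \<Rightarrow> ('f \<Rightarrow> 'b::ab_group_add \<Rightarrow> 'b) \<Rightarrow> 'b set \<Rightarrow> ('b \<Rightarrow> 'b \<Rightarrow> 'b) \<Rightarrow> ('a \<Rightarrow> 'b) \<Rightarrow> bool" where
  "evolution_envelope s A mulA t E mulE \<Phi> \<longleftrightarrow>
     commutative_algebra_on s A mulA \<and>
     evolution_algebra t E mulE \<and>
     algebra_hom s A mulA t E mulE \<Phi> \<and> inj_on \<Phi> A \<and>
     module.span t {mulE x y | x y. x \<in> E \<and> y \<in> E} \<subseteq> \<Phi> ` A"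

definition square_map :: "('a \<Rightarrow> 'a \<Rightarrow> 'a) \<Rightarrow> 'a \<Rightarrow> 'a" where
  "square_map mul x = mul x x"

definition polarization_mul ::
  "('f::field \<Rightarrow> 'a::ab_group_add \<Rightarrow> 'a) \<Rightarrow> ('a \<Rightarrow> 'a) \<Rightarrow> 'a \<Rightarrow> 'a \<Rightarrow> 'a" where
  "polarization_mul s H x y = s (1 / 2) (H (x + y) - H x - H y)"

text \<open>\<open>F\<^sup>m\<close> is the space of the sequences that vanish from index \<open>m\<close> on; the coordinates have
  the indices \<open>0, \<dots>, m - 1\<close>.\<close>

definition coord_space :: "nat \<Rightarrow> (nat \<Rightarrow> 'f::field) set" where
  "coord_space m = {y. \<forall>k\<ge>m. y k = 0}"

definition coord_scale :: "'f::field \<Rightarrow> (nat \<Rightarrow> 'f) \<Rightarrow> nat \<Rightarrow> 'f" where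
  "coord_scale c y = (\<lambda>k. c * y k)"

text \<open>\<open>H = D \<circ> L\<close> is a Waring decomposition of length \<open>m\<close>. The \<open>l k\<close> are in the dual of \<open>V\<close>:
  the one-dimensional target space is the field itself, with its multiplication as scaling.\<close>

definition waring_decomposition ::
  "('f::field \<Rightarrow> 'a::ab_group_add \<Rightarrow> 'a) \<Rightarrow> 'a set \<Rightarrow> ('a \<Rightarrow> 'a) \<Rightarrow> nat
    \<Rightarrow> ('a \<Rightarrow> nat \<Rightarrow> 'f) \<Rightarrow> ((nat \<Rightarrow> 'f) \<Rightarrow> 'a) \<Rightarrow> bool" where
  "waring_decomposition s V H m L D \<longleftrightarrow>
     (\<exists>l v. (\<forall>k<m. linear_map_on s V (*) UNIV (l k)) \<and>
            (\<forall>k<m. v k \<in> V) \<and>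
            (\<forall>x\<in>V. L x = (\<lambda>k. if k < m then l k x else 0)) \<and>
            (\<forall>y\<in>coord_space m. D y = (\<Sum>k<m. s ((y k)\<^sup>2) (v k))) \<and>
            (\<forall>x\<in>V. H x = D (L x)))"

text \<open>The identification of \<open>F\<^sup>m\<close> with a space that has the basis \<open>e 0, \<dots>, e (m - 1)\<close>.\<close>

definition from_coords ::
  "('f::field \<Rightarrow> 'a::ab_group_add \<Rightarrow> 'a) \<Rightarrow> nat \<Rightarrow> (nat \<Rightarrow> 'a) \<Rightarrow> (nat \<Rightarrow> 'f) \<Rightarrow> 'a" where
  "from_coords s m e y = (\<Sum>k<m. s (y k) (e k))"

end

theory Submission
  imports Defs
begin

text \<open>
  For a Waring decomposition \<open>H(x) = \<Sum>\<^sub>k l\<^sub>k(x)\<^sup>2 v\<^sub>k\<close> the polarization of \<open>L \<circ> D\<close> is the product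
  \<open>(x, y) \<mapsto> \<Sum>\<^sub>k x\<^sub>k y\<^sub>k L(v\<^sub>k)\<close>, which is diagonal in the standard basis and takes its values
  in the image of \<open>L\<close>; on that image it is the transported product, since \<open>D \<circ> L\<close> is the square
  map of \<open>A\<close>. Conversely, squaring in a natural basis \<open>e\<^sub>k\<close> gives \<open>\<Sum>\<^sub>k y\<^sub>k\<^sup>2 e\<^sub>k\<^sup>2\<close>, and the
  vectors \<open>e\<^sub>k\<^sup>2\<close> lie in the image of \<open>\<Phi>\<close>, so they pull back to vectors \<open>v\<^sub>k\<close> of \<open>A\<close>.
\<close>

section \<open>Linear maps on carriers\<close>

lemma linear_map_onD:
  assumes "linear_map_on s V t W f"
  shows "x \<in> V \<Longrightarrow> f x \<in> W"
    and "x \<in> V \<Longrightarrow> y \<in> V \<Longrightarrow> f (x + y) = f x + f y"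
    and "x \<in> V \<Longrightarrow> f (s c x) = t c (f x)"
  using assms unfolding linear_map_on_def by auto

context vector_space
begin

lemma linear_map_on_zero:
  assumes "subspace V" "linear_map_on scale V t W f"
  shows "f 0 = 0"
  using linear_map_onD(2)[OF assms(2), of 0 0] subspace_0[OF assms(1)] by simp

lemma linear_map_on_diff:
  assumes "subspace V" "linear_map_on scale V t W f" "x \<in> V" "y \<in> V"
  shows "f (x - y) = f x - f y"
  using linear_map_onD(2)[OF assms(2), of "x - y" y] subspace_diff[OF assms(1,3,4)] assms(4)
  by simp

lemma linear_map_on_sum:
  assumes "subspace V" "linear_map_on scale V t W f" "finite K" "\<And>k. k \<in> K \<Longrightarrow> x k \<in> V"
  shows "f (\<Sum>k\<in>K. x k) = (\<Sum>k\<in>K. f (x k))"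
  using assms(3,4)
proof (induction K rule: finite_induct)
  case empty
  show ?case using linear_map_on_zero[OF assms(1,2)] by simp
next
  case (insert k K)
  have "(\<Sum>k\<in>K. x k) \<in> V"
    using insert.prems by (intro subspace_sum[OF assms(1)]) auto
  then have "f (x k + (\<Sum>k\<in>K. x k)) = f (x k) + f (\<Sum>k\<in>K. x k)"
    using insert.prems by (intro linear_map_onD(2)[OF assms(2)]) auto
  then show ?case using insert by simp
qed

text \<open>In one direction this reduces \<open>E^2\<close> lying in an image to the products lying
  there; in the other it makes the image of \<open>\<Phi>\<close> a carrier on which the inverse can
  be treated as linear.\<close>

lemma linear_map_on_image_subspace:
  assumes "subspace V" "linear_map_on scale V t W f" "vector_space t"
  shows "module.subspace t (f ` V)"
proof -
  interpret T: vector_space t by fact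
  show ?thesis
  proof (rule T.subspaceI)
    show "0 \<in> f ` V"
      using linear_map_on_zero[OF assms(1,2)] subspace_0[OF assms(1)] by (metis image_eqI)
  next
    fix x y assume "x \<in> f ` V" "y \<in> f ` V"
    then obtain a b where "a \<in> V" "x = f a" "b \<in> V" "y = f b" by auto
    then show "x + y \<in> f ` V"
      using linear_map_onD(2)[OF assms(2)] subspace_add[OF assms(1)] by (metis image_eqI)
  next
    fix c x assume "x \<in> f ` V"
    then obtain a where "a \<in> V" "x = f a" by auto
    then show "t c x \<in> f ` V"
      using linear_map_onD(3)[OF assms(2)] subspace_scale[OF assms(1)] by (metis image_eqI)
  qed
qed

text \<open>Serves two inverses: the pullback along \<open>\<Phi>\<close>, meaningful only on its
  image, and the coordinate map of a natural basis.\<close>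

lemma linear_map_on_the_inv_into:
  assumes "subspace V" "linear_map_on scale V t W f" "inj_on f V"
  shows "linear_map_on t (f ` V) scale V (the_inv_into V f)"
  unfolding linear_map_on_def
proof (intro conjI ballI allI)
  show "the_inv_into V f ` f ` V \<subseteq> V"
    using the_inv_into_onto[OF assms(3)] by simp
next
  fix x y assume "x \<in> f ` V" "y \<in> f ` V"
  then obtain a b where ab: "a \<in> V" "x = f a" "b \<in> V" "y = f b" by auto
  then have "x + y = f (a + b)" using linear_map_onD(2)[OF assms(2)] by simp
  then show "the_inv_into V f (x + y) = the_inv_into V f x + the_inv_into V f y"
    using ab subspace_add[OF assms(1)] by (simp add: the_inv_into_f_f[OF assms(3)])
next
  fix c x assume "x \<in> f ` V"
  then obtain a where a: "a \<in> V" "x = f a" by auto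
  then have "t c x = f (scale c a)" using linear_map_onD(3)[OF assms(2)] by simp
  then show "the_inv_into V f (t c x) = scale c (the_inv_into V f x)"
    using a subspace_scale[OF assms(1)] by (simp add: the_inv_into_f_f[OF assms(3)])
qed

end

lemma linear_map_on_comp:
  assumes "linear_map_on s V t W f" "linear_map_on t W u X g"
  shows "linear_map_on s V u X (g \<circ> f)"
  using assms unfolding linear_map_on_def by (auto simp: image_subset_iff)

section \<open>Coordinate spaces\<close>

interpretation coord: vector_space "coord_scale :: 'f::field \<Rightarrow> (nat \<Rightarrow> 'f) \<Rightarrow> nat \<Rightarrow> 'f"
  by unfold_locales (auto simp: coord_scale_def fun_eq_iff algebra_simps)

lemma subspace_coord_space: "coord.subspace (coord_space m :: (nat \<Rightarrow> 'f::field) set)"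
  by (rule coord.subspaceI) (auto simp: coord_space_def coord_scale_def)

lemma sum_coord_apply: "(\<Sum>k\<in>K. f k) i = (\<Sum>k\<in>K. f k i)"
  for f :: "'b \<Rightarrow> nat \<Rightarrow> 'f::field"
  by (induction K rule: infinite_finite_induct) auto

text \<open>The standard basis vectors; as indices start at \<open>0\<close>, those lying in
  \<open>coord_space m\<close> are the ones with \<open>k < m\<close>.\<close>

definition coord_unit :: "nat \<Rightarrow> nat \<Rightarrow> 'f::field" where
  "coord_unit k = (\<lambda>i. if i = k then 1 else 0)"

lemma inj_coord_unit: "inj (coord_unit :: nat \<Rightarrow> nat \<Rightarrow> 'f::field)"
  by (rule injI) (metis coord_unit_def zero_neq_one)

text \<open>Both halves of the basis property rest on this: evaluation at an index recovers the
  coefficient (independence), and a vector vanishing from \<open>m\<close> on is rebuilt from its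
  own coordinates (spanning).\<close>

lemma sum_scale_coord_unit:
  "(\<Sum>k<m. coord_scale (c k) (coord_unit k)) = (\<lambda>i. if i < m then c i else (0::'f::field))"
  by (auto simp: fun_eq_iff sum_coord_apply coord_scale_def coord_unit_def if_distrib cong: if_cong)

lemma is_basis_coord_unit:
  "is_basis coord_scale (coord_space m) (coord_unit ` {..<m} :: (nat \<Rightarrow> 'f::field) set)"
  unfolding is_basis_def
proof
  have inj: "inj_on (coord_unit :: nat \<Rightarrow> nat \<Rightarrow> 'f) {..<m}"
    using inj_coord_unit by (rule inj_on_subset) simp
  show "\<not> coord.dependent (coord_unit ` {..<m} :: (nat \<Rightarrow> 'f) set)"
  proof (rule coord.independent_if_scalars_zero)
    fix c :: "(nat \<Rightarrow> 'f) \<Rightarrow> 'f" and b :: "nat \<Rightarrow> 'f"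
    assume 0: "(\<Sum>b\<in>coord_unit ` {..<m}. coord_scale (c b) b) = 0"
      and "b \<in> coord_unit ` {..<m}"
    then obtain k where k: "k < m" "b = coord_unit k" by auto
    have "(\<lambda>i. if i < m then c (coord_unit i) else 0) = 0"
      using 0 by (simp add: sum.reindex[OF inj] sum_scale_coord_unit)
    from fun_cong[OF this, of k] show "c b = 0" using k by simp
  qed simp
  show "coord.span (coord_unit ` {..<m} :: (nat \<Rightarrow> 'f) set) = coord_space m"
  proof
    show "coord.span (coord_unit ` {..<m} :: (nat \<Rightarrow> 'f) set) \<subseteq> coord_space m"
      by (rule coord.span_minimal[OF _ subspace_coord_space])
        (auto simp: coord_space_def coord_unit_def)
    show "coord_space m \<subseteq> coord.span (coord_unit ` {..<m} :: (nat \<Rightarrow> 'f) set)"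
    proof
      fix y :: "nat \<Rightarrow> 'f" assume "y \<in> coord_space m"
      then have "y = (\<Sum>k<m. coord_scale (y k) (coord_unit k))"
        by (auto simp: sum_scale_coord_unit coord_space_def fun_eq_iff)
      also have "\<dots> \<in> coord.span (coord_unit ` {..<m})"
        by (intro coord.span_sum coord.span_scale coord.span_base) auto
      finally show "y \<in> coord.span (coord_unit ` {..<m})" .
    qed
  qed
qed

section \<open>Coordinates with respect to a finite basis\<close>

context vector_space
begin

lemma linear_from_coords:
  assumes "subspace V" "\<And>k. k < m \<Longrightarrow> e k \<in> V"
  shows "linear_map_on coord_scale (coord_space m) scale V (from_coords scale m e)"
  unfolding linear_map_on_def from_coords_def
  using assms
  by (auto simp: scale_left_distrib sum.distrib coord_scale_def scale_sum_right
      intro!: subspace_sum subspace_scale)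

text \<open>Independence of \<open>B\<close> gives injectivity and spanning gives surjectivity; the
  zero tail in \<open>coord_space m\<close> leaves no freedom from index \<open>m\<close>
  on.\<close>

lemma bij_betw_from_coords:
  assumes "is_basis scale V B" "bij_betw e {..<m} B"
  shows "bij_betw (from_coords scale m e) (coord_space m) V"
proof -
  have indep: "\<not> dependent B" and span: "span B = V"
    using assms(1) by (auto simp: is_basis_def)
  have inj: "inj_on e {..<m}" and B: "B = e ` {..<m}"
    using assms(2) by (auto simp: bij_betw_def)
  have "finite B" by (simp add: B)
  have "inj_on (from_coords scale m e) (coord_space m)"
  proof (rule inj_onI)
    fix x y assume xy: "x \<in> coord_space m" "y \<in> coord_space m"
      and eq: "from_coords scale m e x = from_coords scale m e y"
    \<comment> \<open>Independence concerns coefficients indexed by basis vectors, so the coordinate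
      differences are transported along the inverse of the enumeration \<open>e\<close>.\<close>
    define g where "g b = x (the_inv_into {..<m} e b) - y (the_inv_into {..<m} e b)" for b
    have "(\<Sum>b\<in>B. scale (g b) b) = (\<Sum>k<m. scale (x k - y k) (e k))"
      unfolding B sum.reindex[OF inj]
      by (intro sum.cong) (auto simp: g_def the_inv_into_f_f[OF inj])
    also have "\<dots> = 0"
      using eq by (simp add: from_coords_def scale_left_diff_distrib sum_subtractf)
    finally have 0: "(\<Sum>b\<in>B. scale (g b) b) = 0" .
    have "g (e k) = 0" if "k < m" for k
      using independentD[OF indep \<open>finite B\<close> order.refl 0] that B by auto
    then have "x k = y k" if "k < m" for k
      using that by (simp add: g_def the_inv_into_f_f[OF inj])
    then show "x = y"
      using xy by (auto simp: coord_space_def fun_eq_iff) (metis not_le)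
  qed
  moreover have "from_coords scale m e ` coord_space m = V"
  proof
    show "from_coords scale m e ` coord_space m \<subseteq> V"
      unfolding span[symmetric] from_coords_def
      by (auto simp: B intro!: span_sum span_scale intro: span_base)
    show "V \<subseteq> from_coords scale m e ` coord_space m"
    proof
      fix z assume "z \<in> V"
      then obtain u where u: "z = (\<Sum>b\<in>B. scale (u b) b)"
        using span span_finite[OF \<open>finite B\<close>] by auto
      let ?y = "\<lambda>k. if k < m then u (e k) else 0"
      have "z = from_coords scale m e ?y"
        unfolding u B sum.reindex[OF inj] from_coords_def by (intro sum.cong) auto
      moreover have "?y \<in> coord_space m" by (simp add: coord_space_def)
      ultimately show "z \<in> from_coords scale m e ` coord_space m" by blast
    qed
  qed
  ultimately show ?thesis by (simp add: bij_betw_def)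
qed

end

section \<open>From a Waring decomposition to an evolution envelope\<close>

text \<open>If 2 were zero, the characteristic would divide 2, hence be 1 or 2; the value 1 is
  impossible because 0 and 1 differ in a field.\<close>

lemma two_neq_zero_if_CHAR_neq_2:
  assumes "CHAR('f::field) \<noteq> 2"
  shows "(2::'f) \<noteq> 0"
proof
  assume "(2::'f) = 0"
  then have "CHAR('f) dvd 2"
    using of_nat_eq_0_iff_char_dvd[of 2, where 'a='f] by simp
  then have "CHAR('f) \<le> 2" "CHAR('f) \<noteq> 0"
    by (simp add: dvd_imp_le, metis dvd_0_left_iff zero_neq_numeral)
  with assms have "CHAR('f) = 1" by linarith
  then show False by simp
qed

text \<open>Coefficientwise, \<open>(x k + y k)^2 - (x k)^2 - (y k)^2 = 2 * (x k * y k)\<close>;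
  linearity moves the 2 through \<open>L\<close>, where the factor \<open>1 / 2\<close> cancels it.
  The quadratic definition of the product thus becomes a visibly bilinear formula.\<close>

lemma (in vector_space) polarization_diagonal:
  assumes two: "(2::'a) \<noteq> 0" and V: "subspace V"
    and L: "linear_map_on scale V coord_scale W L"
    and v: "\<And>k. k < m \<Longrightarrow> v k \<in> V"
    and D: "\<And>y. y \<in> coord_space m \<Longrightarrow> D y = (\<Sum>k<m. scale ((y k)\<^sup>2) (v k))"
    and xy: "x \<in> coord_space m" "y \<in> coord_space m"
  shows "polarization_mul coord_scale (L \<circ> D) x y = L (\<Sum>k<m. scale (x k * y k) (v k))"
proof -
  \<comment> \<open>\<open>L\<close> is additive only on \<open>V\<close>, so values of
    \<open>D\<close> must be placed in \<open>V\<close> before \<open>L\<close> is applied to their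
    differences.\<close>
  have DV: "D z \<in> V" if "z \<in> coord_space m" for z
    unfolding D[OF that] using v by (auto intro!: subspace_sum subspace_scale V)
  have add: "x + y \<in> coord_space m"
    using coord.subspace_add[OF subspace_coord_space] xy .
  let ?G = "\<Sum>k<m. scale (x k * y k) (v k)"
  have G: "?G \<in> V" using v by (auto intro!: subspace_sum subspace_scale V)
  have "D (x + y) - D x - D y = (\<Sum>k<m. scale (2 * (x k * y k)) (v k))"
    unfolding D[OF add] D[OF xy(1)] D[OF xy(2)] sum_subtractf[symmetric]
    by (intro sum.cong refl)
      (simp add: scale_left_diff_distrib[symmetric] power2_eq_square algebra_simps)
  also have "\<dots> = scale 2 ?G" by (simp add: scale_sum_right)
  finally have *: "D (x + y) - D x - D y = scale 2 ?G" .
  have "L (D (x + y)) - L (D x) - L (D y) = L (D (x + y) - D x - D y)"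
    using DV add xy by (simp add: linear_map_on_diff[OF V L] subspace_diff[OF V])
  also have "\<dots> = coord_scale 2 (L ?G)"
    unfolding * by (rule linear_map_onD(3)[OF L G])
  finally show ?thesis
    using two by (simp add: polarization_mul_def)
qed

text \<open>The diagonal formula yields bilinearity, the natural basis and the containment of
  \<open>E^2\<close> in the image of \<open>L\<close>; the equation \<open>H = D \<circ> L\<close>
  is what makes \<open>L\<close> multiplicative.\<close>

lemma waring_imp_evolution_envelope:
  fixes s :: "'f::field \<Rightarrow> 'a::ab_group_add \<Rightarrow> 'a"
  assumes two: "(2::'f) \<noteq> 0"
    and alg: "commutative_algebra_on s A mul"
    and W: "waring_decomposition s A (square_map mul) m L D"
    and inj: "inj_on L A"
  shows "evolution_envelope s A mul
    coord_scale (coord_space m) (polarization_mul coord_scale (L \<circ> D)) L"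
proof -
  interpret A: commutative_algebra_on s A mul by fact
  obtain l v where "(\<forall>k<m. linear_map_on s A (*) UNIV (l k)) \<and> (\<forall>k<m. v k \<in> A) \<and>
      (\<forall>x\<in>A. L x = (\<lambda>k. if k < m then l k x else 0)) \<and>
      (\<forall>y\<in>coord_space m. D y = (\<Sum>k<m. s ((y k)\<^sup>2) (v k))) \<and>
      (\<forall>x\<in>A. square_map mul x = D (L x))"
    using W unfolding waring_decomposition_def by (elim exE)
  then have l: "\<And>k. k < m \<Longrightarrow> linear_map_on s A (*) UNIV (l k)"
    and v: "\<And>k. k < m \<Longrightarrow> v k \<in> A"
    and Ll: "\<And>x. x \<in> A \<Longrightarrow> L x = (\<lambda>k. if k < m then l k x else 0)"
    and D: "\<And>y. y \<in> coord_space m \<Longrightarrow> D y = (\<Sum>k<m. s ((y k)\<^sup>2) (v k))"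
    and H: "\<And>x. x \<in> A \<Longrightarrow> mul x x = D (L x)"
    unfolding square_map_def by blast+
  have L: "linear_map_on s A coord_scale (coord_space m) L"
    unfolding linear_map_on_def
  proof (intro conjI ballI allI)
    show "L ` A \<subseteq> coord_space m"
      by (auto simp: Ll coord_space_def)
  next
    fix x y assume "x \<in> A" "y \<in> A"
    then show "L (x + y) = L x + L y"
      using A.subspace_add[OF A.subspace_carrier]
      by (simp add: Ll linear_map_onD(2)[OF l] fun_eq_iff)
  next
    fix c x assume "x \<in> A"
    then show "L (s c x) = coord_scale c (L x)"
      using A.subspace_scale[OF A.subspace_carrier]
      by (simp add: Ll linear_map_onD(3)[OF l] fun_eq_iff coord_scale_def)
  qed
  let ?mul = "polarization_mul coord_scale (L \<circ> D)"
  \<comment> \<open>\<open>?G\<close> is bilinear with values in \<open>A\<close>, and the product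
    is \<open>L\<close> applied to it; the algebra laws are checked on \<open>?G\<close> and carried
    over by linearity of \<open>L\<close>.\<close>
  let ?G = "\<lambda>x y. \<Sum>k<m. s (x k * y k) (v k)"
  have mul: "?mul x y = L (?G x y)" if "x \<in> coord_space m" "y \<in> coord_space m" for x y
    by (rule A.polarization_diagonal[OF two A.subspace_carrier L v D that])
  have G: "?G x y \<in> A" for x y
    using v by (auto intro!: A.subspace_sum A.subspace_scale A.subspace_carrier)
  note Cadd = coord.subspace_add[OF subspace_coord_space]
  note Cscale = coord.subspace_scale[OF subspace_coord_space]
  have alg_on: "algebra_on coord_scale (coord_space m) ?mul"
  proof unfold_locales
    fix x y z :: "nat \<Rightarrow> 'f" and c
    assume x: "x \<in> coord_space m" and y: "y \<in> coord_space m"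
    show "?mul x y \<in> coord_space m"
      unfolding mul[OF x y] by (rule linear_map_onD(1)[OF L G])
    have "?G (coord_scale c x) y = s c (?G x y)"
      by (simp add: coord_scale_def A.scale_sum_right mult.assoc)
    then show "?mul (coord_scale c x) y = coord_scale c (?mul x y)"
      by (simp add: mul x y Cscale linear_map_onD(3)[OF L G])
    have "?G x (coord_scale c y) = s c (?G x y)"
      by (simp add: coord_scale_def A.scale_sum_right mult.left_commute)
    then show "?mul x (coord_scale c y) = coord_scale c (?mul x y)"
      by (simp add: mul x y Cscale linear_map_onD(3)[OF L G])
    \<comment> \<open>Closure and the scaling laws concern two vectors; the third enters with the
      distributive laws.\<close>
    assume z: "z \<in> coord_space m"
    have "?G (x + y) z = ?G x z + ?G y z"
      by (simp add: distrib_right A.scale_left_distrib sum.distrib)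
    then show "?mul (x + y) z = ?mul x z + ?mul y z"
      by (simp add: mul x y z Cadd linear_map_onD(2)[OF L G G])
    have "?G x (y + z) = ?G x y + ?G x z"
      by (simp add: distrib_left A.scale_left_distrib sum.distrib)
    then show "?mul x (y + z) = ?mul x y + ?mul x z"
      by (simp add: mul x y z Cadd linear_map_onD(2)[OF L G G])
  qed (rule subspace_coord_space)
  have unit: "coord_unit k \<in> coord_space m" if "k < m" for k
    using that by (auto simp: coord_unit_def coord_space_def)
  have "natural_basis coord_scale (coord_space m) ?mul (coord_unit ` {..<m})"
    unfolding natural_basis_def
  proof (intro conjI ballI impI is_basis_coord_unit)
    fix b c :: "nat \<Rightarrow> 'f"
    assume "b \<in> coord_unit ` {..<m}" "c \<in> coord_unit ` {..<m}" "b \<noteq> c"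
    then obtain i j where ij: "i < m" "b = coord_unit i" "j < m" "c = coord_unit j" "i \<noteq> j"
      by auto
    \<comment> \<open>At every index at least one of the two unit vectors has coordinate
      \<open>0\<close>, because \<open>i \<noteq> j\<close>.\<close>
    have "?G b c = 0"
      using ij by (intro sum.neutral) (auto simp: coord_unit_def)
    moreover have "?mul b c = L (?G b c)"
      using ij unit by (intro mul) auto
    ultimately show "?mul b c = 0"
      using A.linear_map_on_zero[OF A.subspace_carrier L] by metis
  qed
  then have evo: "evolution_algebra coord_scale (coord_space m) ?mul"
    using alg_on by (auto simp: evolution_algebra_def)
  \<comment> \<open>Squares match, since \<open>L (mul x x) = (L \<circ> D) (L x)\<close> by the
    decomposition; polarizing both sides extends this to all products.\<close>
  have hom: "L (mul x y) = ?mul (L x) (L y)" if x: "x \<in> A" and y: "y \<in> A" for x y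
  proof -
    note mulA = A.mul_closed and diff = A.subspace_diff[OF A.subspace_carrier]
      and add = A.subspace_add[OF A.subspace_carrier]
    \<comment> \<open>Commutativity of \<open>A\<close> merges the two cross terms.\<close>
    have "mul (x + y) (x + y) - mul x x - mul y y = mul x y + mul x y"
      using x y add A.mul_commute[OF y x] by (simp add: A.mul_add_left A.mul_add_right)
    also have "\<dots> = s 2 (mul x y)"
      using A.scale_left_distrib[of 1 1 "mul x y"] by simp
    finally have *: "mul (x + y) (x + y) - mul x x - mul y y = s 2 (mul x y)" .
    \<comment> \<open>Since \<open>L x + L y = L (x + y)\<close>, each of the three values is
      \<open>L\<close> of a square in \<open>A\<close>.\<close>
    have "(L \<circ> D) (L x + L y) - (L \<circ> D) (L x) - (L \<circ> D) (L y)
        = L (mul (x + y) (x + y)) - L (mul x x) - L (mul y y)"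
      using x y add by (simp add: H linear_map_onD(2)[OF L])
    also have "\<dots> = L (mul (x + y) (x + y) - mul x x - mul y y)"
      using x y add mulA diff by (simp add: A.linear_map_on_diff[OF A.subspace_carrier L])
    also have "\<dots> = coord_scale 2 (L (mul x y))"
      unfolding * using x y mulA by (intro linear_map_onD(3)[OF L]) auto
    finally show ?thesis using two by (simp add: polarization_mul_def)
  qed
  have "coord.span {?mul x y | x y. x \<in> coord_space m \<and> y \<in> coord_space m} \<subseteq> L ` A"
  proof (rule coord.span_minimal)
    show "coord.subspace (L ` A)"
      by (rule A.linear_map_on_image_subspace[OF A.subspace_carrier L coord.vector_space_axioms])
    show "{?mul x y | x y. x \<in> coord_space m \<and> y \<in> coord_space m} \<subseteq> L ` A"
      using mul G by auto
  qed
  then show ?thesis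
    using alg evo L hom inj by (simp add: evolution_envelope_def algebra_hom_def)
qed

section \<open>From an evolution envelope to a Waring decomposition\<close>

lemma (in algebra_on) mul_sum_left:
  assumes "finite K" "\<And>k. k \<in> K \<Longrightarrow> x k \<in> A" "y \<in> A"
  shows "mul (\<Sum>k\<in>K. x k) y = (\<Sum>k\<in>K. mul (x k) y)"
proof (rule linear_map_on_sum[OF subspace_carrier])
  show "linear_map_on scale A scale A (\<lambda>x. mul x y)"
    using assms(3) by (auto simp: linear_map_on_def mul_closed mul_add_left mul_scale_left)
qed (use assms in auto)

lemma (in algebra_on) mul_sum_right:
  assumes "finite K" "\<And>k. k \<in> K \<Longrightarrow> y k \<in> A" "x \<in> A"
  shows "mul x (\<Sum>k\<in>K. y k) = (\<Sum>k\<in>K. mul x (y k))"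
proof (rule linear_map_on_sum[OF subspace_carrier])
  show "linear_map_on scale A scale A (mul x)"
    using assms(3) by (auto simp: linear_map_on_def mul_closed mul_add_right mul_scale_right)
qed (use assms in auto)

text \<open>Bilinear expansion gives a double sum over pairs of indices, and orthogonality leaves
  only its diagonal.\<close>

lemma (in algebra_on) square_from_coords:
  assumes e: "\<And>k. k < m \<Longrightarrow> e k \<in> A"
    and orth: "\<And>j k. j < m \<Longrightarrow> k < m \<Longrightarrow> j \<noteq> k \<Longrightarrow> mul (e j) (e k) = 0"
  shows "mul (from_coords scale m e y) (from_coords scale m e y)
    = (\<Sum>k<m. scale ((y k)\<^sup>2) (mul (e k) (e k)))"
proof -
  have ye: "scale (y k) (e k) \<in> A" if "k < m" for k
    using e that subspace_scale[OF subspace_carrier] by simp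
  have sum: "(\<Sum>k<m. scale (y k) (e k)) \<in> A"
    using ye by (intro subspace_sum[OF subspace_carrier]) auto
  have "mul (scale (y j) (e j)) (\<Sum>k<m. scale (y k) (e k)) = scale ((y j)\<^sup>2) (mul (e j) (e j))"
    if j: "j < m" for j
  proof -
    have "mul (scale (y j) (e j)) (\<Sum>k<m. scale (y k) (e k))
        = (\<Sum>k<m. mul (scale (y j) (e j)) (scale (y k) (e k)))"
      using ye j by (intro mul_sum_right) auto
    also have "\<dots> = (\<Sum>k<m. if k = j then scale ((y j)\<^sup>2) (mul (e j) (e j)) else 0)"
      using j e ye orth
      by (intro sum.cong) (auto simp: mul_scale_left mul_scale_right power2_eq_square)
    also have "\<dots> = scale ((y j)\<^sup>2) (mul (e j) (e j))"
      using j by simp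
    finally show ?thesis .
  qed
  moreover have "mul (\<Sum>k<m. scale (y k) (e k)) (\<Sum>k<m. scale (y k) (e k))
      = (\<Sum>j<m. mul (scale (y j) (e j)) (\<Sum>k<m. scale (y k) (e k)))"
    using ye sum by (intro mul_sum_left) auto
  ultimately show ?thesis by (simp add: from_coords_def)
qed

text \<open>The linear forms are the coordinates of \<open>\<Phi> x\<close> in the natural basis.
  The identification is the bijection \<open>\<iota>\<close>, which cancels in
  \<open>D \<circ> L\<close>.\<close>

lemma evolution_envelope_imp_waring:
  fixes sA :: "'f::field \<Rightarrow> 'a::ab_group_add \<Rightarrow> 'a"
    and sE :: "'f \<Rightarrow> 'e::ab_group_add \<Rightarrow> 'e"
  assumes env: "evolution_envelope sA A mulA sE E mulE \<Phi>"
    and nat: "natural_basis sE E mulE B"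
    and e: "bij_betw e {..<m} B"
  defines "\<iota> \<equiv> from_coords sE m e"
  defines "L \<equiv> the_inv_into (coord_space m) \<iota> \<circ> \<Phi>"
  defines "D \<equiv> the_inv_into A \<Phi> \<circ> square_map mulE \<circ> \<iota>"
  shows "waring_decomposition sA A (square_map mulA) m L D" and "inj_on L A"
proof -
  interpret A: commutative_algebra_on sA A mulA
    using env by (simp add: evolution_envelope_def)
  interpret E: algebra_on sE E mulE
    using env by (simp add: evolution_envelope_def evolution_algebra_def)
  have \<Phi>: "linear_map_on sA A sE E \<Phi>"
    and \<Phi>_mul: "\<And>x y. x \<in> A \<Longrightarrow> y \<in> A \<Longrightarrow> \<Phi> (mulA x y) = mulE (\<Phi> x) (\<Phi> y)"
    and \<Phi>_inj: "inj_on \<Phi> A"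
    and span: "E.span {mulE x y | x y. x \<in> E \<and> y \<in> E} \<subseteq> \<Phi> ` A"
    using env by (auto simp: evolution_envelope_def algebra_hom_def)
  have basis: "is_basis sE E B" using nat by (simp add: natural_basis_def)
  have eB: "e k \<in> B" if "k < m" for k
    using e that by (auto simp: bij_betw_def)
  have eE: "e k \<in> E" if "k < m" for k
    using basis E.span_base[OF eB[OF that]] by (simp add: is_basis_def)
  \<comment> \<open>A natural basis constrains distinct vectors, so injectivity of \<open>e\<close>
    is needed to apply it to distinct indices.\<close>
  have orth: "mulE (e j) (e k) = 0" if "j < m" "k < m" "j \<noteq> k" for j k
  proof -
    have "e j \<noteq> e k" using e that by (auto simp: bij_betw_def inj_on_def)
    then show ?thesis using nat eB that by (simp add: natural_basis_def)
  qed
  have bij: "bij_betw \<iota> (coord_space m) E"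
    unfolding \<iota>_def by (rule E.bij_betw_from_coords[OF basis e])
  then have \<iota>_inj: "inj_on \<iota> (coord_space m)" and \<iota>_im: "\<iota> ` coord_space m = E"
    by (auto simp: bij_betw_def)
  have \<iota>: "linear_map_on coord_scale (coord_space m) sE E \<iota>"
    unfolding \<iota>_def by (rule E.linear_from_coords[OF E.subspace_carrier eE])
  have "linear_map_on sE E coord_scale (coord_space m) (the_inv_into (coord_space m) \<iota>)"
    using coord.linear_map_on_the_inv_into[OF subspace_coord_space \<iota> \<iota>_inj] by (simp add: \<iota>_im)
  then have L: "linear_map_on sA A coord_scale (coord_space m) L"
    unfolding L_def by (rule linear_map_on_comp[OF \<Phi>])
  \<comment> \<open>This relation lets \<open>L\<close> inherit injectivity from
    \<open>\<Phi>\<close>, and it later evaluates \<open>D (L x)\<close>.\<close>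
  have \<iota>_L: "\<iota> (L x) = \<Phi> x" if "x \<in> A" for x
    using linear_map_onD(1)[OF \<Phi> that] by (simp add: L_def f_the_inv_into_f[OF \<iota>_inj] \<iota>_im)
  show "inj_on L A"
    using \<iota>_L \<Phi>_inj by (metis inj_on_def)

  \<comment> \<open>Here \<open>E^2 \<subseteq> \<Phi>(A)\<close> enters: outside the image of
    \<open>\<Phi>\<close> the map \<open>the_inv_into A \<Phi>\<close> has no specified
    value.\<close>
  have ee: "mulE (e k) (e k) \<in> \<Phi> ` A" if "k < m" for k
    using span eE[OF that] E.span_base[of _ "{mulE x y | x y. x \<in> E \<and> y \<in> E}"] by blast
  note inv = A.linear_map_on_the_inv_into[OF A.subspace_carrier \<Phi> \<Phi>_inj]
  have sub: "E.subspace (\<Phi> ` A)"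
    by (rule A.linear_map_on_image_subspace[OF A.subspace_carrier \<Phi> E.vector_space_axioms])
  define v where "v k = the_inv_into A \<Phi> (mulE (e k) (e k))" for k
  \<comment> \<open>This holds for every sequence, as \<open>\<iota>\<close> reads only the first
    \<open>m\<close> coordinates. The inverse of \<open>\<Phi>\<close> may be exchanged with the sum
    because each summand lies in the image.\<close>
  have Dy: "D y = (\<Sum>k<m. sA ((y k)\<^sup>2) (v k))" for y
  proof -
    have "D y = the_inv_into A \<Phi> (\<Sum>k<m. sE ((y k)\<^sup>2) (mulE (e k) (e k)))"
      using E.square_from_coords[OF eE orth] by (simp add: D_def square_map_def \<iota>_def)
    also have "\<dots> = (\<Sum>k<m. the_inv_into A \<Phi> (sE ((y k)\<^sup>2) (mulE (e k) (e k))))"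
      using ee by (intro E.linear_map_on_sum[OF sub inv] E.subspace_scale[OF sub]) auto
    also have "\<dots> = (\<Sum>k<m. sA ((y k)\<^sup>2) (v k))"
      using ee by (intro sum.cong) (auto simp: v_def linear_map_onD(3)[OF inv])
    finally show ?thesis .
  qed
  have vA: "v k \<in> A" if "k < m" for k
    unfolding v_def by (rule linear_map_onD(1)[OF inv ee[OF that]])
  have lin: "linear_map_on sA A (*) UNIV (\<lambda>x. L x k)" for k
    by (simp add: linear_map_on_def linear_map_onD(2,3)[OF L] coord_scale_def)
  have Lx: "L x = (\<lambda>k. if k < m then L x k else 0)" if "x \<in> A" for x
    using linear_map_onD(1)[OF L that] by (auto simp: coord_space_def fun_eq_iff)
  \<comment> \<open>\<open>D (L x)\<close> is the preimage of the square of \<open>\<Phi> x\<close>,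
    which by multiplicativity is \<open>\<Phi>\<close> of the square of \<open>x\<close>.\<close>
  have sq: "square_map mulA x = D (L x)" if "x \<in> A" for x
    using that A.mul_closed \<Phi>_mul[OF that that, symmetric]
    by (simp add: D_def square_map_def \<iota>_L the_inv_into_f_f[OF \<Phi>_inj])
  show "waring_decomposition sA A (square_map mulA) m L D"
    unfolding waring_decomposition_def
  proof (intro exI conjI allI ballI impI)
    show "D y = (\<Sum>k<m. sA ((y k)\<^sup>2) (v k))" for y by (rule Dy)
    show "linear_map_on sA A (*) UNIV (\<lambda>x. L x k)" for k by (rule lin)
    show "L x = (\<lambda>k. if k < m then L x k else 0)" if "x \<in> A" for x by (rule Lx[OF that])
  qed (use vA sq in auto)
qed

theorem theorem4p2:
  fixes sA :: "'f::field \<Rightarrow> 'a::ab_group_add \<Rightarrow> 'a"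
    and A :: "'a set"
    and mulA :: "'a \<Rightarrow> 'a \<Rightarrow> 'a"
    and H :: "'a \<Rightarrow> 'a"
  assumes char: "CHAR('f) \<noteq> 2"
    and alg: "commutative_algebra_on sA A mulA"
    and fin: "finite_dimensional sA A"
    and H: "H = square_map mulA"
  shows
    "(\<forall>(m::nat) (L :: 'a \<Rightarrow> nat \<Rightarrow> 'f) (D :: (nat \<Rightarrow> 'f) \<Rightarrow> 'a).
        waring_decomposition sA A H m L D \<longrightarrow> inj_on L A \<longrightarrow>
        evolution_envelope sA A mulA
          coord_scale (coord_space m) (polarization_mul coord_scale (L \<circ> D)) L)
     \<and>
     (\<forall>(sE :: 'f \<Rightarrow> 'e::ab_group_add \<Rightarrow> 'e) (E :: 'e set) (mulE :: 'e \<Rightarrow> 'e \<Rightarrow> 'e) (\<Phi> :: 'a \<Rightarrow> 'e)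
        (m::nat) (B :: 'e set) (e :: nat \<Rightarrow> 'e).
        evolution_envelope sA A mulA sE E mulE \<Phi> \<longrightarrow> has_dimension sE E m \<longrightarrow>
        natural_basis sE E mulE B \<longrightarrow> bij_betw e {..<m} B \<longrightarrow>
        (let \<iota> = from_coords sE m e;
             L = the_inv_into (coord_space m) \<iota> \<circ> \<Phi>;
             D = the_inv_into A \<Phi> \<circ> square_map mulE \<circ> \<iota>
         in waring_decomposition sA A H m L D \<and> inj_on L A))"
  unfolding H Let_def
proof (intro conjI allI impI)
  fix m :: nat and L D
  assume "waring_decomposition sA A (square_map mulA) m L D" "inj_on L A"
  then show "evolution_envelope sA A mulA
      coord_scale (coord_space m) (polarization_mul coord_scale (L \<circ> D)) L"
    by (rule waring_imp_evolution_envelope[OF two_neq_zero_if_CHAR_neq_2[OF char] alg])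
next
  fix sE :: "'f \<Rightarrow> 'e \<Rightarrow> 'e" and E mulE and \<Phi> and m :: nat and B e
  assume "evolution_envelope sA A mulA sE E mulE \<Phi>" "natural_basis sE E mulE B"
    "bij_betw e {..<m} B"
  note waring = evolution_envelope_imp_waring[OF this]
  show "waring_decomposition sA A (square_map mulA) m
      (the_inv_into (coord_space m) (from_coords sE m e) \<circ> \<Phi>)
      (the_inv_into A \<Phi> \<circ> square_map mulE \<circ> from_coords sE m e)"
    by (rule waring(1))
  show "inj_on (the_inv_into (coord_space m) (from_coords sE m e) \<circ> \<Phi>) A"
    by (rule waring(2))
qed

end
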